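(* Let $n\ge 2$, let $1\le i<j\le k\le n-1$, and let $\bar v\in\mathbb{C}^{n(n+1)/2}$ be a $1$-singular vector with $\bar v_{ki}=\bar v_{kj}$. Let $V(T(\bar v))$ be the associated $1$-singular Gelfand-Tsetlin $\mathfrak{gl}(n)$-module. If $V(T(\bar v))$ is irreducible, then $\bar v_{rs}-\bar v_{r-1,t}\notin\mathbb{Z}$ for all $r,s,t$ with $2\le r\le n$, $1\le s\le r$ and $1\le t\le r-1$.
   Context: Ground field $\mathbb{C}$; $\mathfrak{gl}(n)$ has standard basis $E_{pq}$. Vectors in $\mathbb{C}^{n(n+1)/2}$ are written $v=(v_{rs})_{1\le s\le r\le n}$ (row $r$ has $r$ entries; row $n$ is the top row). $\delta^{rs}$ is the vector with $1$ in position $(r,s)$ and $0$ elsewhere. $\mathbb{Z}^{n(n-1)/2}$ is identified with the integer vectors $w=(w_{rs})_{1\le s\le r\le n}$ whose top row is zero. Fix $1\le i<j\le k\le n-1$. A vector $\bar v$ is $1$-singular (at $(k,i,j)$) if $\bar v_{ki}-\bar v_{kj}\in\mathbb{Z}$ and $\bar v_{rs}-\bar v_{rt}\notin\mathbb{Z}$ for all $1\le s<t\le r\le n-1$ with $(r,s,t)\ne(k,i,j)$. Fix such $\bar v$ with $\bar v_{ki}=\bar v_{kj}$. Let $\tau$ be the map on vectors exchanging the entries in positions $(k,i)$ and $(k,j)$ and fixing all others. $V(T(\bar v))$ is the complex vector space spanned by formal symbols $T(\bar v+w)$ (regular tableaux) and $\mathcal{D}T(\bar v+w)$ (derivative tableaux),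 $w\in\mathbb{Z}^{n(n-1)/2}$, subject only to the relations $T(\bar v+w)=T(\bar v+\tau(w))$ and $\mathcal{D}T(\bar v+w)+\mathcal{D}T(\bar v+\tau(w))=0$. It has basis $\{Tab(w): w\in\mathbb{Z}^{n(n-1)/2}\}$, where $Tab(w)=T(\bar v+w)$ if $w_{ki}-w_{kj}\le 0$ and $Tab(w)=\mathcal{D}T(\bar v+w)$ if $w_{ki}-w_{kj}>0$. Module structure. For a rational function $f$ in variables $v=(v_{rs})$ that is smooth on the hyperplane $v_{ki}=v_{kj}$ (near $\bar v$) put $\mathcal{D}^{\bar v}(f)=\frac12\left(\frac{\partial f}{\partial v_{ki}}-\frac{\partial f}{\partial v_{kj}}\right)(\bar v)$. For $1\le s\le r\le n-1$ put $a^+_{rs}(v)=-\frac{\prod_{q=1}^{r+1}(v_{rs}-v_{r+1,q})}{\prod_{q\ne s}(v_{rs}-v_{rq})}$, $\quad a^-_{rs}(v)=\frac{\prod_{q=1}^{r-1}(v_{rs}-v_{r-1,q})}{\prod_{q\ne s}(v_{rs}-v_{rq})}$ (in the denominators $1\le q\le r$). Write $E_r^+=E_{r,r+1}$, $E_r^-=E_{r+1,r}$. By a known theorem, $V(T(\bar v))$ is a $\mathfrak{gl}(n)$-module with action on generators $E_r^{\pm}\,T(\bar v+z)=\sum_{s=1}^r\Big[\mathcal{D}^{\bar v}\big((v_{ki}-v_{kj})a^{\pm}_{rs}(v+z)\big)\,T(\bar v+z\pm\delta^{rs})+\big((v_{ki}-v_{kj})a^{\pm}_{rs}(v+z)\big)\big|_{v=\bar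 v}\,\mathcal{D}T(\bar v+z\pm\delta^{rs})\Big]$ for all $z$; $E_r^{\pm}\,\mathcal{D}T(\bar v+z)=\sum_{s=1}^r\Big[\mathcal{D}^{\bar v}\big(a^{\pm}_{rs}(v+z)\big)\,T(\bar v+z\pm\delta^{rs})+a^{\pm}_{rs}(\bar v+z)\,\mathcal{D}T(\bar v+z\pm\delta^{rs})\Big]$ for $z\ne\tau(z)$; and $E_{rr}$ acts on both $T(\bar v+z)$ and $\mathcal{D}T(\bar v+z)$ by the scalar $r-1+\sum_{q=1}^r(\bar v+z)_{rq}-\sum_{q=1}^{r-1}(\bar v+z)_{r-1,q}$. *)

theory Defs
  imports
    "HOL-Analysis.Analysis"
    "HOL-Library.Poly_Mapping"
    "Jordan_Normal_Form.Matrix"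
begin

text \<open>
  Positions \<open>(r, s)\<close> are 1-based pairs of naturals, and a vector is a function on all pairs of
  which only the entries with \<open>1 \<le> s \<le> r \<le> n\<close> matter.
\<close>

type_synonym cvec = "nat \<times> nat \<Rightarrow> complex"
type_synonym shift = "nat \<times> nat \<Rightarrow> int"

definition delta :: "nat \<Rightarrow> nat \<Rightarrow> shift"
  where "delta r s = (\<lambda>p. if p = (r, s) then 1 else 0)"

definition shift_by :: "int \<Rightarrow> nat \<Rightarrow> nat \<Rightarrow> shift \<Rightarrow> shift"
  where "shift_by e r s z = (\<lambda>p. z p + e * delta r s p)"

definition shifted :: "cvec \<Rightarrow> shift \<Rightarrow> cvec"
  where "shifted v z = (\<lambda>p. v p + of_int (z p))"

definition shifts :: "nat \<Rightarrow> shift set"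
  where "shifts n = {w. \<forall>r s. \<not> (1 \<le> s \<and> s \<le> r \<and> r \<le> n - 1) \<longrightarrow> w (r, s) = 0}"

definition tau :: "nat \<Rightarrow> nat \<Rightarrow> nat \<Rightarrow> shift \<Rightarrow> shift"
  where "tau k i j w = w((k, i) := w (k, j), (k, j) := w (k, i))"

definition one_singular :: "nat \<Rightarrow> nat \<Rightarrow> nat \<Rightarrow> nat \<Rightarrow> cvec \<Rightarrow> bool"
  where "one_singular n k i j v \<longleftrightarrow>
    v (k, i) - v (k, j) \<in> \<int> \<and>
    (\<forall>r s t. 1 \<le> s \<and> s < t \<and> t \<le> r \<and> r \<le> n - 1 \<and> (r, s, t) \<noteq> (k, i, j)
        \<longrightarrow> v (r, s) - v (r, t) \<notin> \<int>)"


subsection \<open>The Lie algebra and its modules\<close>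

text \<open>Matrix indices in the library are 0-based, hence the shift by one.\<close>

definition Emat :: "nat \<Rightarrow> nat \<Rightarrow> nat \<Rightarrow> complex mat"
  where "Emat n p q = mat n n (\<lambda>(a, b). if Suc a = p \<and> Suc b = q then 1 else 0)"

locale gl_module = vector_space scale
  for scale :: "complex \<Rightarrow> 'v::ab_group_add \<Rightarrow> 'v" +
  fixes n :: nat and V :: "'v set" and \<rho> :: "complex mat \<Rightarrow> 'v \<Rightarrow> 'v"
  assumes subspace_V: "subspace V"
    and closed: "\<lbrakk>A \<in> carrier_mat n n; x \<in> V\<rbrakk> \<Longrightarrow> \<rho> A x \<in> V"
    and add_right: "\<lbrakk>A \<in> carrier_mat n n; x \<in> V; y \<in> V\<rbrakk> \<Longrightarrow> \<rho> A (x + y) = \<rho> A x + \<rho> A y"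
    and scale_right: "\<lbrakk>A \<in> carrier_mat n n; x \<in> V\<rbrakk> \<Longrightarrow> \<rho> A (scale c x) = scale c (\<rho> A x)"
    and add_left: "\<lbrakk>A \<in> carrier_mat n n; B \<in> carrier_mat n n; x \<in> V\<rbrakk>
        \<Longrightarrow> \<rho> (A + B) x = \<rho> A x + \<rho> B x"
    and scale_left: "\<lbrakk>A \<in> carrier_mat n n; x \<in> V\<rbrakk> \<Longrightarrow> \<rho> (c \<cdot>\<^sub>m A) x = scale c (\<rho> A x)"
    and bracket: "\<lbrakk>A \<in> carrier_mat n n; B \<in> carrier_mat n n; x \<in> V\<rbrakk>
        \<Longrightarrow> \<rho> (A * B - B * A) x = \<rho> A (\<rho> B x) - \<rho> B (\<rho> A x)"
begin

definition submodule :: "'v set \<Rightarrow> bool"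
  where "submodule W \<longleftrightarrow>
    subspace W \<and> W \<subseteq> V \<and> (\<forall>A \<in> carrier_mat n n. \<forall>x \<in> W. \<rho> A x \<in> W)"

definition irreducible_module :: bool
  where "irreducible_module \<longleftrightarrow>
    V \<noteq> {0} \<and> (\<forall>W. submodule W \<longrightarrow> W = {0} \<or> W = V)"

end


subsection \<open>The space of tableaux\<close>

text \<open>
  The presented space is realised on its basis of symbols \<open>Tab(w)\<close>: a vector is a finitely supported
  coefficient function on the shifts, and a tableau which is not itself a basis symbol is rewritten
  with the defining relations.  The base vector only enters the names of the symbols.  The lemmas
  below show that this is the space with the given presentation: the relations hold, the tableaux
  span, and the space is universal among spaces with these properties.
\<close>

type_synonym tabvec = "shift \<Rightarrow>\<^sub>0 complex"

definition tab_scale :: "complex \<Rightarrow> tabvec \<Rightarrow> tabvec"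
  where "tab_scale c x = Poly_Mapping.map ((*) c) x"

definition tab_space :: "nat \<Rightarrow> tabvec set"
  where "tab_space n = {x. Poly_Mapping.keys x \<subseteq> shifts n}"

definition Treg :: "nat \<Rightarrow> nat \<Rightarrow> nat \<Rightarrow> shift \<Rightarrow> tabvec"
  where "Treg k i j w =
    (if w (k, i) - w (k, j) \<le> 0 then Poly_Mapping.single w 1
     else Poly_Mapping.single (tau k i j w) 1)"

definition Tder :: "nat \<Rightarrow> nat \<Rightarrow> nat \<Rightarrow> shift \<Rightarrow> tabvec"
  where "Tder k i j w =
    (if w (k, i) - w (k, j) > 0 then Poly_Mapping.single w 1
     else if w (k, i) - w (k, j) = 0 then 0
     else - Poly_Mapping.single (tau k i j w) 1)"

lemma lookup_tab_scale: "Poly_Mapping.lookup (tab_scale c x) w = c * Poly_Mapping.lookup x w"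
  by (simp add: tab_scale_def Poly_Mapping.map.rep_eq when_def)

interpretation tab: vector_space tab_scale
  by unfold_locales
    (auto intro!: poly_mapping_eqI simp: lookup_tab_scale lookup_add algebra_simps)

lemma tau_tau: "tau k i j (tau k i j w) = w"
  by (auto simp: tau_def fun_eq_iff)

lemma tau_shifts:
  assumes "1 \<le> i" "i < j" "j \<le> k" "k \<le> n - 1" "w \<in> shifts n"
  shows "tau k i j w \<in> shifts n"
  using assms by (auto simp: tau_def shifts_def)

lemma tau_fixed: "tau k i j w = w" if "w (k, i) = w (k, j)"
  using that by (auto simp: tau_def fun_eq_iff)

lemma tau_at:
  assumes "i \<noteq> j"
  shows "tau k i j w (k, i) = w (k, j)" "tau k i j w (k, j) = w (k, i)"
  using assms by (auto simp: tau_def)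

lemma Treg_relation: "i \<noteq> j \<Longrightarrow> Treg k i j w = Treg k i j (tau k i j w)"
  using tau_fixed[of w k i j] by (auto simp: Treg_def tau_at tau_tau)

lemma Tder_relation: "i \<noteq> j \<Longrightarrow> Tder k i j w + Tder k i j (tau k i j w) = 0"
  by (auto simp: Tder_def tau_at tau_tau)

lemma subspace_tab_space: "tab.subspace (tab_space n)"
  unfolding tab.subspace_def tab_space_def
proof (intro conjI ballI allI)
  fix x y :: tabvec
  assume "x \<in> {x. Poly_Mapping.keys x \<subseteq> shifts n}" "y \<in> {x. Poly_Mapping.keys x \<subseteq> shifts n}"
  then show "x + y \<in> {x. Poly_Mapping.keys x \<subseteq> shifts n}"
    using Poly_Mapping.keys_add[of x y] by auto
next
  fix c and x :: tabvec
  assume "x \<in> {x. Poly_Mapping.keys x \<subseteq> shifts n}"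
  then show "tab_scale c x \<in> {x. Poly_Mapping.keys x \<subseteq> shifts n}"
    by (auto simp: in_keys_iff lookup_tab_scale)
qed auto

lemma tabvec_expand:
  "x = (\<Sum>w\<in>Poly_Mapping.keys x. tab_scale (Poly_Mapping.lookup x w) (Poly_Mapping.single w 1))"
proof (rule poly_mapping_eqI)
  fix u
  show "Poly_Mapping.lookup x u = Poly_Mapping.lookup (\<Sum>w\<in>Poly_Mapping.keys x.
      tab_scale (Poly_Mapping.lookup x w) (Poly_Mapping.single w 1)) u"
    by (auto simp: lookup_sum lookup_tab_scale lookup_single when_def sum.delta in_keys_iff
        if_distrib cong: if_cong)
qed

lemma tab_space_span:
  assumes "1 \<le> i" "i < j" "j \<le> k" "k \<le> n - 1"
  shows "tab_space n = tab.span (Treg k i j ` shifts n \<union> Tder k i j ` shifts n)" (is "_ = tab.span ?S")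
proof (intro equalityI subsetI)
  fix x assume x: "x \<in> tab_space n"
  have s: "Poly_Mapping.single w 1 \<in> ?S" if "w \<in> shifts n" for w :: shift
    using that by (cases "w (k, i) - w (k, j) \<le> 0")
      (force simp: Treg_def Tder_def intro!: image_eqI[of _ _ w])+
  have "(\<Sum>w\<in>Poly_Mapping.keys x. tab_scale (Poly_Mapping.lookup x w) (Poly_Mapping.single w 1)) \<in> tab.span ?S"
    using x s by (intro tab.span_sum tab.span_scale tab.span_base) (auto simp: tab_space_def)
  then show "x \<in> tab.span ?S" using tabvec_expand[of x] by simp
next
  have "?S \<subseteq> tab_space n"
    using tau_shifts[OF assms] by (auto simp: tab_space_def Treg_def Tder_def split: if_splits)
  then show "x \<in> tab_space n" if "x \<in> tab.span ?S" for x
    using that subspace_tab_space[of n] tab.span_minimal by blast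
qed

lemma tab_space_universal:
  fixes scale' :: "complex \<Rightarrow> 'b::ab_group_add \<Rightarrow> 'b" and t d :: "shift \<Rightarrow> 'b"
  assumes "vector_space scale'" and "i \<noteq> j"
    and t: "\<And>w. w \<in> shifts n \<Longrightarrow> t w = t (tau k i j w)"
    and d: "\<And>w. w \<in> shifts n \<Longrightarrow> d w + d (tau k i j w) = 0"
  shows "\<exists>f. Vector_Spaces.linear tab_scale scale' f \<and>
    (\<forall>w \<in> shifts n. f (Treg k i j w) = t w \<and> f (Tder k i j w) = d w)"
proof -
  interpret W: vector_space scale' by fact
  interpret P: vector_space_pair tab_scale scale' ..
  define b where "b w = (if w (k, i) - w (k, j) \<le> 0 then t w else d w)" for w :: shift
  define f where "f x = (\<Sum>w\<in>Poly_Mapping.keys x. scale' (Poly_Mapping.lookup x w) (b w))" for x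
  have f_sup: "f x = (\<Sum>w\<in>A. scale' (Poly_Mapping.lookup x w) (b w))"
    if "finite A" "Poly_Mapping.keys x \<subseteq> A" for x A
    unfolding f_def using that by (intro sum.mono_neutral_left) (auto simp: in_keys_iff)
  have add: "f (x + y) = f x + f y" for x y
  proof -
    let ?A = "Poly_Mapping.keys x \<union> Poly_Mapping.keys y"
    show ?thesis
      using Poly_Mapping.keys_add[of x y]
      by (simp add: f_sup[of ?A] lookup_add W.scale_left_distrib sum.distrib)
  qed
  have sc: "f (tab_scale c x) = scale' c (f x)" for c x
    by (subst f_sup[of "Poly_Mapping.keys x"])
      (auto simp: in_keys_iff lookup_tab_scale f_def W.scale_sum_right)
  have lin: "Vector_Spaces.linear tab_scale scale' f"
    by (intro Vector_Spaces.linear.intro module_hom.intro module_hom_axioms.intro tab.module_axioms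
        W.module_axioms tab.vector_space_axioms W.vector_space_axioms add sc)
  interpret f: Vector_Spaces.linear tab_scale scale' f by fact
  have single: "f (Poly_Mapping.single w 1) = b w" for w
    by (simp add: f_def)
  have "f (Treg k i j w) = t w" if w: "w \<in> shifts n" for w
    using t[OF w] \<open>i \<noteq> j\<close> by (auto simp: Treg_def single b_def tau_at)
  moreover have "f (Tder k i j w) = d w" if w: "w \<in> shifts n" for w
  proof -
    have "d w = 0" if "w (k, i) = w (k, j)"
    proof -
      have "d w + d w = 0" using d[OF w] tau_fixed[OF that] by simp
      then have "scale' 2 (d w) = 0"
        using W.scale_left_distrib[of 1 1 "d w"] by simp
      then show ?thesis by simp
    qed
    moreover have "d w = - d (tau k i j w)"
      using d[OF w] by (simp add: eq_neg_iff_add_eq_0)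
    ultimately show ?thesis
      using \<open>i \<noteq> j\<close> by (simp add: Tder_def single b_def tau_at f.neg)
  qed
  ultimately show ?thesis using lin by blast
qed


subsection \<open>The module structure\<close>

text \<open>
  Functions such as \<open>(v\<^sub>k\<^sub>i - v\<^sub>k\<^sub>j) a(v + z)\<close> are meant as rational functions, but the defining
  quotient may be \<open>0 / 0\<close> (hence \<open>0\<close> in HOL) on the hyperplane \<open>v\<^sub>k\<^sub>i = v\<^sub>k\<^sub>j\<close> although the rational
  function is smooth there.  The value of the rational function is recovered as the limit from the
  complement of the hyperplane.
\<close>

definition rat_val :: "nat \<Rightarrow> nat \<Rightarrow> nat \<Rightarrow> (cvec \<Rightarrow> complex) \<Rightarrow> cvec \<Rightarrow> complex"
  where "rat_val k i j f v = Lim (at v within {u. u (k, i) \<noteq> u (k, j)}) f"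

lemma rat_val_eqI:
  assumes "i \<noteq> j" and g: "(g \<longlongrightarrow> g v) (at v)"
    and fg: "eventually (\<lambda>u. u (k, i) \<noteq> u (k, j) \<longrightarrow> f u = g u) (at v)"
  shows "rat_val k i j f v = g v"
proof -
  let ?S = "{u. u (k, i) \<noteq> u (k, j)} :: cvec set"
  define c where "c t = v((k, i) := v (k, i) + t)" for t
  have "continuous_on UNIV c"
  proof (rule continuous_on_coordinatewise_then_product)
    fix p show "continuous_on UNIV (\<lambda>t. c t p)"
      by (cases "p = (k, i)") (simp_all add: c_def fun_upd_apply continuous_intros)
  qed
  then have "(c \<longlongrightarrow> c 0) (at 0)"
    by (simp add: continuous_on_def)
  then have c_lim: "(c \<longlongrightarrow> v) (at 0)"
    by (simp add: c_def)
  have c_off: "eventually (\<lambda>t. c t \<in> ?S \<and> c t \<noteq> v) (at 0)"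
  proof (cases "v (k, j) = v (k, i)")
    case True
    then show ?thesis using \<open>i \<noteq> j\<close>
      by (auto simp: eventually_at_filter c_def fun_eq_iff)
  next
    case False
    then have "eventually (\<lambda>t. t \<noteq> v (k, j) - v (k, i)) (at 0)"
      by (intro eventually_neq_at_within)
    then show ?thesis using eventually_neq_at_within[of 0 0 UNIV]
      by eventually_elim (use \<open>i \<noteq> j\<close> in \<open>auto simp: c_def fun_eq_iff algebra_simps\<close>)
  qed
  have "filterlim c (at v within ?S) (at 0)"
    using c_lim c_off by (auto simp: filterlim_at)
  then have nontriv: "at v within ?S \<noteq> bot"
    using filtermap_bot_iff[of c "at 0"] by (metis at_neq_bot filterlim_def le_bot)
  have "(g \<longlongrightarrow> g v) (at v within ?S)"
    using g by (rule tendsto_within_subset) auto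
  moreover have "eventually (\<lambda>u. f u = g u) (at v within ?S)"
    using fg by (auto simp: eventually_at_filter elim: eventually_mono)
  ultimately have "(f \<longlongrightarrow> g v) (at v within ?S)"
    by (subst tendsto_cong)
  then show ?thesis
    unfolding rat_val_def using nontriv by (intro tendsto_Lim)
qed

definition pderiv_at :: "nat \<times> nat \<Rightarrow> (cvec \<Rightarrow> complex) \<Rightarrow> cvec \<Rightarrow> complex"
  where "pderiv_at p f v = deriv (\<lambda>t. f (v(p := t))) (v p)"

definition Dv :: "nat \<Rightarrow> nat \<Rightarrow> nat \<Rightarrow> cvec \<Rightarrow> (cvec \<Rightarrow> complex) \<Rightarrow> complex"
  where "Dv k i j vbar f =
    (pderiv_at (k, i) (rat_val k i j f) vbar - pderiv_at (k, j) (rat_val k i j f) vbar) / 2"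

definition a_plus :: "nat \<Rightarrow> nat \<Rightarrow> cvec \<Rightarrow> complex"
  where "a_plus r s v =
    - (\<Prod>q = 1..r + 1. v (r, s) - v (r + 1, q)) / (\<Prod>q \<in> {1..r} - {s}. v (r, s) - v (r, q))"

definition a_minus :: "nat \<Rightarrow> nat \<Rightarrow> cvec \<Rightarrow> complex"
  where "a_minus r s v =
    (\<Prod>q = 1..r - 1. v (r, s) - v (r - 1, q)) / (\<Prod>q \<in> {1..r} - {s}. v (r, s) - v (r, q))"

definition T_image ::
  "nat \<Rightarrow> nat \<Rightarrow> nat \<Rightarrow> cvec \<Rightarrow> nat \<Rightarrow> (nat \<Rightarrow> cvec \<Rightarrow> complex) \<Rightarrow> (nat \<Rightarrow> shift) \<Rightarrow> shift \<Rightarrow> tabvec"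
  where "T_image k i j vbar r a z' z =
    (\<Sum>s = 1..r.
      let f = (\<lambda>v. (v (k, i) - v (k, j)) * a s (shifted v z))
      in tab_scale (Dv k i j vbar f) (Treg k i j (z' s))
         + tab_scale (rat_val k i j f vbar) (Tder k i j (z' s)))"

definition D_image ::
  "nat \<Rightarrow> nat \<Rightarrow> nat \<Rightarrow> cvec \<Rightarrow> nat \<Rightarrow> (nat \<Rightarrow> cvec \<Rightarrow> complex) \<Rightarrow> (nat \<Rightarrow> shift) \<Rightarrow> shift \<Rightarrow> tabvec"
  where "D_image k i j vbar r a z' z =
    (\<Sum>s = 1..r.
      tab_scale (Dv k i j vbar (\<lambda>v. a s (shifted v z))) (Treg k i j (z' s))
      + tab_scale (a s (shifted vbar z)) (Tder k i j (z' s)))"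

definition weight :: "nat \<Rightarrow> cvec \<Rightarrow> complex"
  where "weight r v = of_nat r - 1 + (\<Sum>q = 1..r. v (r, q)) - (\<Sum>q = 1..r - 1. v (r - 1, q))"

text \<open>
  \<open>\<rho>\<close> is the \<open>gl(n)\<close>-module structure on the tableau space determined by the formulas on generators.
\<close>

locale singular_GT_module =
  gl_module tab_scale n "tab_space n" \<rho> for n :: nat and \<rho> :: "complex mat \<Rightarrow> tabvec \<Rightarrow> tabvec" +
  fixes k i j :: nat and vbar :: cvec
  assumes raise_T: "\<lbrakk>1 \<le> r; r \<le> n - 1; z \<in> shifts n\<rbrakk> \<Longrightarrow>
      \<rho> (Emat n r (r + 1)) (Treg k i j z) = T_image k i j vbar r (a_plus r) (\<lambda>s. shift_by 1 r s z) z"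
    and lower_T: "\<lbrakk>1 \<le> r; r \<le> n - 1; z \<in> shifts n\<rbrakk> \<Longrightarrow>
      \<rho> (Emat n (r + 1) r) (Treg k i j z) = T_image k i j vbar r (a_minus r) (\<lambda>s. shift_by (- 1) r s z) z"
    and raise_D: "\<lbrakk>1 \<le> r; r \<le> n - 1; z \<in> shifts n; z \<noteq> tau k i j z\<rbrakk> \<Longrightarrow>
      \<rho> (Emat n r (r + 1)) (Tder k i j z) = D_image k i j vbar r (a_plus r) (\<lambda>s. shift_by 1 r s z) z"
    and lower_D: "\<lbrakk>1 \<le> r; r \<le> n - 1; z \<in> shifts n; z \<noteq> tau k i j z\<rbrakk> \<Longrightarrow>
      \<rho> (Emat n (r + 1) r) (Tder k i j z) = D_image k i j vbar r (a_minus r) (\<lambda>s. shift_by (- 1) r s z) z"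
    and diag_T: "\<lbrakk>1 \<le> r; r \<le> n; z \<in> shifts n\<rbrakk> \<Longrightarrow>
      \<rho> (Emat n r r) (Treg k i j z) = tab_scale (weight r (shifted vbar z)) (Treg k i j z)"
    and diag_D: "\<lbrakk>1 \<le> r; r \<le> n; z \<in> shifts n\<rbrakk> \<Longrightarrow>
      \<rho> (Emat n r r) (Tder k i j z) = tab_scale (weight r (shifted vbar z)) (Tder k i j z)"

end

theory Submission
  imports Defs
begin

text \<open>
  Suppose \<open>v\<^sub>R\<^sub>S - v\<^sub>R\<^sub>-\<^sub>1\<^sub>,\<^sub>T = m\<close> is an integer and put \<open>D\<^sub>1(w) = m + w\<^sub>R\<^sub>S - w\<^sub>R\<^sub>-\<^sub>1\<^sub>,\<^sub>T\<close>, \<open>D\<^sub>2 = D\<^sub>1 \<circ> \<tau>\<close>.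
  A step that takes \<open>D\<^sub>1\<close> or \<open>D\<^sub>2\<close> from \<open>0\<close> to \<open>-1\<close> has a coefficient whose numerator vanishes at the
  base point.  Hence the regular tableaux with \<open>D\<^sub>1 \<ge> 0\<close> or \<open>D\<^sub>2 \<ge> 0\<close> together with the derivative
  tableaux with \<open>D\<^sub>1 \<ge> 0\<close> and \<open>D\<^sub>2 \<ge> 0\<close> span a submodule: a derivative tableau may cross one of the
  two walls at the price of becoming regular, because only the undifferentiated coefficient vanishes
  there, and a regular tableau cannot cross the second wall.
\<close>

section \<open>Modules over gl(n): closure under the generators suffices\<close>

lemma (in gl_module) map_sum:
  assumes "A \<in> carrier_mat n n" "finite K" "\<And>w. w \<in> K \<Longrightarrow> b w \<in> V"
  shows "\<rho> A (\<Sum>w\<in>K. scale (c w) (b w)) = (\<Sum>w\<in>K. scale (c w) (\<rho> A (b w)))"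
  using assms(2,3)
proof (induction K rule: finite_induct)
  case empty
  have "\<rho> A (scale 0 0) = scale 0 (\<rho> A 0)"
    using assms(1) subspace_0[OF subspace_V] by (rule scale_right)
  then show ?case by simp
next
  case (insert w K)
  have "scale (c w) (b w) \<in> V" "(\<Sum>w\<in>K. scale (c w) (b w)) \<in> V"
    using insert subspace_V by (auto intro!: subspace_sum subspace_scale)
  then show ?case using insert assms(1) by (simp add: add_right scale_right)
qed

lemma Emat_carrier [simp]: "Emat n p q \<in> carrier_mat n n"
  by (simp add: Emat_def)

lemma Emat_mult:
  assumes "1 \<le> q" "q \<le> n"
  shows "Emat n p q * Emat n r s = (if q = r then Emat n p s else 0\<^sub>m n n)"
proof (rule eq_matI)
  fix a b
  assume "a < dim_row (if q = r then Emat n p s else 0\<^sub>m n n)"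
    and "b < dim_col (if q = r then Emat n p s else 0\<^sub>m n n)"
  then have ab: "a < n" "b < n" by (auto simp: Emat_def split: if_splits)
  have "(Emat n p q * Emat n r s) $$ (a, b)
      = (\<Sum>c = 0..<n. (if Suc a = p \<and> Suc c = q then 1 else 0) * (if Suc c = r \<and> Suc b = s then 1 else 0))"
    using ab by (simp add: Emat_def scalar_prod_def)
  also have "\<dots> = (\<Sum>c = 0..<n. if c = q - 1 then (if Suc a = p \<and> q = r \<and> Suc b = s then 1 else 0) else 0)"
    using assms by (intro sum.cong) auto
  also have "\<dots> = (if Suc a = p \<and> q = r \<and> Suc b = s then 1 else 0)"
    using assms by (subst sum.delta) auto
  finally show "(Emat n p q * Emat n r s) $$ (a, b) = (if q = r then Emat n p s else 0\<^sub>m n n) $$ (a, b)"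
    using ab by (simp add: Emat_def)
qed (auto simp: Emat_def)

lemma Emat_bracket:
  assumes "1 \<le> q" "q \<le> n" "1 \<le> s" "s \<le> n" "p \<noteq> s"
  shows "Emat n p q * Emat n q s - Emat n q s * Emat n p q = Emat n p s"
  using assms by (auto simp: Emat_mult intro!: eq_matI) (simp_all add: Emat_def)

text \<open>The matrices that preserve \<open>W\<close> form a Lie subalgebra. Brackets of the given
  generators produce every matrix unit, and these span all matrices.\<close>

lemma (in gl_module) submodule_from_generators:
  assumes W: "subspace W" "W \<subseteq> V"
    and diag: "\<And>r x. \<lbrakk>1 \<le> r; r \<le> n; x \<in> W\<rbrakk> \<Longrightarrow> \<rho> (Emat n r r) x \<in> W"
    and up: "\<And>r x. \<lbrakk>1 \<le> r; r \<le> n - 1; x \<in> W\<rbrakk> \<Longrightarrow> \<rho> (Emat n r (r + 1)) x \<in> W"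
    and low: "\<And>r x. \<lbrakk>1 \<le> r; r \<le> n - 1; x \<in> W\<rbrakk> \<Longrightarrow> \<rho> (Emat n (r + 1) r) x \<in> W"
  shows "submodule W"
proof -
  define stab where "stab A \<longleftrightarrow> A \<in> carrier_mat n n \<and> (\<forall>x\<in>W. \<rho> A x \<in> W)" for A
  have stab_bracket: "stab (A * B - B * A)" if "stab A" "stab B" for A B
    using that W by (auto simp: stab_def bracket subset_iff intro!: subspace_diff)
  have stab_add: "stab (A + B)" if "stab A" "stab B" for A B
    using that W by (auto simp: stab_def add_left subset_iff intro!: subspace_add)
  have stab_smult: "stab (c \<cdot>\<^sub>m A)" if "stab A" for c A
    using that W by (auto simp: stab_def scale_left subset_iff intro!: subspace_scale)
  \<comment> \<open>Induction on the distance from the diagonal, with [E_{pq}, E_{q,q+1}] =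
    E_{p,q+1}.\<close>
  have stab_up: "stab (Emat n p (p + 1 + d))" if "1 \<le> p" "p + 1 + d \<le> n" for p d
    using that
  proof (induction d)
    case 0
    then show ?case using up[of p] by (auto simp: stab_def)
  next
    case (Suc d)
    have "stab (Emat n (p + 1 + d) (p + 1 + d + 1))"
      using Suc.prems up[of "p + 1 + d"] by (auto simp: stab_def)
    moreover have "stab (Emat n p (p + 1 + d))" using Suc by simp
    ultimately show ?case
      using stab_bracket[of "Emat n p (p + 1 + d)" "Emat n (p + 1 + d) (p + 1 + d + 1)"]
        Emat_bracket[of "p + 1 + d" n "p + 1 + d + 1" p] Suc.prems by simp
  qed
  have stab_low: "stab (Emat n (p + 1 + d) p)" if "1 \<le> p" "p + 1 + d \<le> n" for p d
    using that
  proof (induction d)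
    case 0
    then show ?case using low[of p] by (auto simp: stab_def)
  next
    case (Suc d)
    have "stab (Emat n (p + 1 + d + 1) (p + 1 + d))"
      using Suc.prems low[of "p + 1 + d"] by (auto simp: stab_def)
    moreover have "stab (Emat n (p + 1 + d) p)" using Suc by simp
    ultimately show ?case
      using stab_bracket[of "Emat n (p + 1 + d + 1) (p + 1 + d)" "Emat n (p + 1 + d) p"]
        Emat_bracket[of "p + 1 + d" n p "p + 1 + d + 1"] Suc.prems by simp
  qed
  have stab_E: "stab (Emat n p q)" if "1 \<le> p" "p \<le> n" "1 \<le> q" "q \<le> n" for p q
  proof -
    consider "p = q" | "p < q" | "q < p" by linarith
    then show ?thesis
    proof cases
      case 1
      then show ?thesis using that diag by (auto simp: stab_def)
    next
      case 2
      then show ?thesis using that stab_up[of p "q - p - 1"] by simp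
    next
      case 3
      then show ?thesis using that stab_low[of q "p - q - 1"] by simp
    qed
  qed
  \<comment> \<open>A matrix is assembled one entry at a time; \<open>K\<close> holds 0-based
    indices, hence \<open>Suc\<close> in \<open>Emat\<close>.\<close>
  have part: "stab (mat n n (\<lambda>ab. if ab \<in> K then c ab else 0))"
    if "finite K" "K \<subseteq> {..<n} \<times> {..<n}" for K c
    using that
  proof (induction K rule: finite_induct)
    case empty
    have "\<rho> (0\<^sub>m n n) x = 0" if "x \<in> V" for x
      using that scale_left[of "0\<^sub>m n n" x 0] by simp
    moreover have "mat n n (\<lambda>ab. 0 :: complex) = 0\<^sub>m n n" by (rule eq_matI) auto
    ultimately show ?case
      using W by (auto simp: stab_def subset_iff intro!: subspace_0)
  next
    case (insert e K)
    obtain p q where e: "e = (p, q)" by (cases e)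
    have "mat n n (\<lambda>ab. if ab \<in> insert e K then c ab else 0)
        = mat n n (\<lambda>ab. if ab \<in> K then c ab else 0) + c e \<cdot>\<^sub>m Emat n (Suc p) (Suc q)"
      using insert.hyps by (intro eq_matI) (auto simp: Emat_def e)
    moreover have "stab (Emat n (Suc p) (Suc q))"
      using insert.prems e by (intro stab_E) auto
    ultimately show ?case
      using insert by (auto intro!: stab_add stab_smult)
  qed
  have "stab A" if "A \<in> carrier_mat n n" for A
  proof -
    have "A = mat n n (\<lambda>ab. if ab \<in> {..<n} \<times> {..<n} then A $$ ab else 0)"
      using that by (intro eq_matI) auto
    then show ?thesis using part[of "{..<n} \<times> {..<n}" "\<lambda>ab. A $$ ab"] by simp
  qed
  then show ?thesis using W by (auto simp: submodule_def stab_def)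
qed

section \<open>Values and derivatives across the singular hyperplane\<close>

lemma continuous_on_shifted [continuous_intros]:
  "continuous_on U (\<lambda>v. shifted v z p)"
  unfolding shifted_def
  by (intro continuous_intros continuous_on_subset[OF continuous_on_product_coordinates]) auto

lemma continuous_on_coordinate: "continuous_on U (\<lambda>v::cvec. v p)"
  by (rule continuous_on_subset[OF continuous_on_product_coordinates]) auto

lemma rat_val_open:
  assumes "i \<noteq> j" "open U" "continuous_on U g" "v \<in> U"
    and "\<And>u. \<lbrakk>u \<in> U; u (k, i) \<noteq> u (k, j)\<rbrakk> \<Longrightarrow> f u = g u"
  shows "rat_val k i j f v = g v"
proof (rule rat_val_eqI)
  show "(g \<longlongrightarrow> g v) (at v)"
    using assms continuous_on_eq_continuous_at[of U g] by (auto simp: isCont_def)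
  have "eventually (\<lambda>u. u \<in> U) (at v)"
    using assms eventually_at_topological by blast
  then show "eventually (\<lambda>u. u (k, i) \<noteq> u (k, j) \<longrightarrow> f u = g u) (at v)"
    by eventually_elim (use assms in auto)
qed fact

lemma isCont_update: "isCont (\<lambda>t. (v::cvec)(p := t)) c"
proof -
  have "continuous_on UNIV (\<lambda>t. v(p := t))"
  proof (rule continuous_on_coordinatewise_then_product)
    fix q show "continuous_on UNIV (\<lambda>t. (v(p := t)) q)"
      by (cases "q = p") simp_all
  qed
  then show ?thesis by (simp add: continuous_on_eq_continuous_at)
qed

text \<open>Near \<open>v p\<close> the coordinate line stays in \<open>U\<close>, where
  \<open>rat_val\<close> returns \<open>g\<close> itself, so the derivative may be taken of
  \<open>g\<close> directly.\<close>

lemma pderiv_at_rat_val: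
  assumes "i \<noteq> j" "open U" "continuous_on U g" "v \<in> U"
  shows "pderiv_at p (rat_val k i j g) v = deriv (\<lambda>t. g (v(p := t))) (v p)"
  unfolding pderiv_at_def
proof (rule deriv_cong_ev)
  have "((\<lambda>t. v(p := t)) \<longlongrightarrow> v) (nhds (v p))"
    using isCont_update[of "v p" v p] unfolding isCont_def tendsto_at_iff_tendsto_nhds by simp
  then have "eventually (\<lambda>t. v(p := t) \<in> U) (nhds (v p))"
    using assms topological_tendstoD by blast
  then show "eventually (\<lambda>t. rat_val k i j g (v(p := t)) = g (v(p := t))) (nhds (v p))"
    by eventually_elim (use assms in \<open>auto intro: rat_val_open\<close>)
qed simp

text \<open>Caratheodory's criterion: continuity of \<open>h\<close> at \<open>c\<close> is enough,
  so no derivative of a coefficient has to be computed.\<close>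

lemma deriv_linear_times_continuous:
  fixes h :: "complex \<Rightarrow> complex"
  assumes "isCont h c"
  shows "deriv (\<lambda>t. (t - c) * h t) c = h c"
proof (rule DERIV_imp_deriv)
  show "((\<lambda>t. (t - c) * h t) has_field_derivative h c) (at c)"
    unfolding CARAT_DERIV using assms by (intro exI[of _ h]) (auto simp: mult.commute)
qed

lemma deriv_linear_times_continuous':
  fixes h :: "complex \<Rightarrow> complex"
  assumes "isCont h c"
  shows "deriv (\<lambda>t. (c - t) * h t) c = - h c"
  using deriv_linear_times_continuous[of c "\<lambda>t. - h t"] assms
  by (simp add: algebra_simps)

text \<open>The linear factor vanishes at \<open>v\<close>, so the two partial derivatives are
  \<open>h v\<close> and \<open>- h v\<close>, and half their difference is \<open>h v\<close>.
  Where the coefficient is smooth, the action on regular tableaux is thus the classical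
  Gelfand-Tsetlin formula.\<close>

lemma smooth_coefficient:
  assumes "i \<noteq> j" "open U" "continuous_on U h" "v \<in> U" "v (k, i) = v (k, j)"
  shows "rat_val k i j (\<lambda>u. (u (k, i) - u (k, j)) * h u) v = 0"
    and "Dv k i j v (\<lambda>u. (u (k, i) - u (k, j)) * h u) = h v"
proof -
  let ?f = "\<lambda>u::cvec. (u (k, i) - u (k, j)) * h u"
  have f: "continuous_on U ?f"
    by (intro continuous_intros continuous_on_coordinate assms)
  show "rat_val k i j ?f v = 0"
    using rat_val_open[OF assms(1,2) f assms(4), where f = ?f] assms by simp
  have "isCont h v" using assms continuous_on_eq_continuous_at by blast
  then have h: "isCont (\<lambda>t. h (v(p := t))) (v p)" for p
    by (intro isCont_o2[OF isCont_update]) simp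
  \<comment> \<open>The simplifier rewrites \<open>v (k, i)\<close> to \<open>v (k, j)\<close>, so
    the trivial update appears in this form.\<close>
  have upd: "v((k, i) := v (k, j)) = v"
    using assms(5) by (auto simp: fun_eq_iff)
  have "pderiv_at (k, i) (rat_val k i j ?f) v = h v"
    using pderiv_at_rat_val[OF assms(1,2) f assms(4), of "(k, i)" k]
      deriv_linear_times_continuous[OF h[of "(k, i)"]] assms(1,5) upd by simp
  moreover have "pderiv_at (k, j) (rat_val k i j ?f) v = - h v"
    using pderiv_at_rat_val[OF assms(1,2) f assms(4), of "(k, j)" k]
      deriv_linear_times_continuous'[OF h[of "(k, j)"]] assms(1,5) by simp
  ultimately show "Dv k i j v ?f = h v" by (simp add: Dv_def)
qed

text \<open>\<open>Dv\<close> only sees the restrictions of \<open>h\<close> to two coordinate lines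
  through \<open>v\<close>.\<close>

lemma Dv_eq_0:
  assumes "i \<noteq> j" "open U" "continuous_on U h" "v \<in> U"
    and "\<And>t. h (v((k, i) := t)) = 0" "\<And>t. h (v((k, j) := t)) = 0"
  shows "Dv k i j v h = 0"
  unfolding Dv_def by (subst (1 2) pderiv_at_rat_val[OF assms(1-4)]) (simp add: assms(5,6))

section \<open>Gelfand-Tsetlin coefficients and the zeros of their numerators\<close>

definition gt_num :: "nat \<Rightarrow> nat \<Rightarrow> nat \<Rightarrow> cvec \<Rightarrow> complex"
  where "gt_num r' r s v = (\<Prod>q = 1..r'. v (r, s) - v (r', q))"

text \<open>A common form of \<open>a_plus\<close> and \<open>a_minus\<close>, which differ in the
  sign \<open>c\<close> and in the neighbouring row \<open>r'\<close>; one argument then serves both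
  directions.\<close>

definition gt_coeff :: "complex \<Rightarrow> nat \<Rightarrow> nat \<Rightarrow> nat \<Rightarrow> cvec \<Rightarrow> complex"
  where "gt_coeff c r' r s v = c * gt_num r' r s v / (\<Prod>q \<in> {1..r} - {s}. v (r, s) - v (r, q))"

lemma a_plus_eq: "a_plus r = gt_coeff (- 1) (r + 1) r"
  by (simp add: fun_eq_iff a_plus_def gt_coeff_def gt_num_def)

lemma a_minus_eq: "a_minus r = gt_coeff 1 (r - 1) r"
  by (simp add: fun_eq_iff a_minus_def gt_coeff_def gt_num_def)

lemma continuous_on_gt_num: "continuous_on U (\<lambda>v. gt_num r' r s (shifted v z))"
  unfolding gt_num_def by (intro continuous_intros)

lemma one_singular_diff:
  assumes "one_singular n k i j v" "1 \<le> s" "s \<le> r" "1 \<le> q" "q \<le> r" "r \<le> n - 1" "s \<noteq> q"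
    and "r \<noteq> k \<or> {s, q} \<noteq> {i, j}"
  shows "shifted v z (r, s) - shifted v z (r, q) \<noteq> 0"
proof
  assume "shifted v z (r, s) - shifted v z (r, q) = 0"
  then have e: "v (r, s) - v (r, q) = of_int (z (r, q) - z (r, s))"
    by (simp add: shifted_def algebra_simps)
  then have "v (r, q) - v (r, s) = of_int (z (r, s) - z (r, q))"
    by (simp add: algebra_simps)
  with e have "v (r, s) - v (r, q) \<in> \<int>" "v (r, q) - v (r, s) \<in> \<int>" by (metis Ints_of_int)+
  moreover have "v (r, a) - v (r, b) \<notin> \<int>"
    if "1 \<le> a" "a < b" "b \<le> r" "(r, a, b) \<noteq> (k, i, j)" for a b
    using assms(1,6) that unfolding one_singular_def by blast
  moreover have "(r, s, q) \<noteq> (k, i, j)" "(r, q, s) \<noteq> (k, i, j)" using assms(8) by auto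
  moreover have "s < q \<or> q < s" using assms(7) by linarith
  ultimately show False using assms(2-5) by blast
qed

text \<open>The direction \<open>e\<close> is \<open>1\<close> for \<open>E\<^sub>r\<^sup>+\<close> and \<open>- 1\<close> for \<open>E\<^sub>r\<^sup>-\<close>; \<open>r'\<close> is the row in the numerator of \<open>a\<^sub>r\<^sub>s\<^sup>\<plusminus>\<close>.\<close>

locale ladder =
  fixes n :: nat and e :: int and r r' :: nat
  assumes row: "1 \<le> r" "r \<le> n - 1"
    and dir: "e = 1 \<and> r' = r + 1 \<or> e = - 1 \<and> r' = r - 1"

lemma (in ladder) shift_by_shifts:
  "z \<in> shifts n \<Longrightarrow> 1 \<le> s \<Longrightarrow> s \<le> r \<Longrightarrow> shift_by e r s z \<in> shifts n"
  using row by (auto simp: shifts_def shift_by_def delta_def)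

text \<open>A step has length one, so the wall is crossed only from 0, where the entries at
  \<open>(R, S)\<close> and \<open>(R - 1, T)\<close> agree. The moved entry is one of them and the
  other lies in row \<open>r'\<close>, which gives a zero factor.\<close>

lemma (in ladder) crossing:
  assumes "1 \<le> S" "S \<le> R" "1 \<le> T" "T \<le> R - 1"
    and "v (R, S) - v (R - 1, T) = of_int m"
    and "m + z (R, S) - z (R - 1, T) \<ge> 0"
    and "m + shift_by e r s z (R, S) - shift_by e r s z (R - 1, T) < 0"
  shows "gt_num r' r s (shifted v z) = 0"
proof -
  have ne: "R \<noteq> R - 1" using assms by auto
  have cases: "e = 1 \<and> (r, s) = (R - 1, T) \<or> e = - 1 \<and> (r, s) = (R, S)"
    and z: "m + z (R, S) - z (R - 1, T) = 0"
    using assms(6,7) dir ne by (auto simp: shift_by_def delta_def split: if_splits)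
  from z have "of_int (m + z (R, S) - z (R - 1, T)) = (0::complex)" by simp
  then have eq: "shifted v z (R, S) = shifted v z (R - 1, T)"
    using assms(5) by (simp add: shifted_def algebra_simps)
  have "\<exists>q\<in>{1..r'}. shifted v z (r, s) - shifted v z (r', q) = 0"
    using cases dir eq assms(1-4) by (auto intro: bexI[of _ S] bexI[of _ T])
  then show ?thesis by (simp add: gt_num_def)
qed

section \<open>The subspace cut out by the two walls\<close>

text \<open>
  Either \<open>D1 = D2\<close> does not involve the positions \<open>(k, i)\<close>, \<open>(k, j)\<close>, or the two functions involve one
  of these positions each.  The assumption \<open>D_double\<close> has content only in the first case.
\<close>

locale GT_barrier = singular_GT_module +
  fixes D1 D2 :: "shift \<Rightarrow> int"
  assumes idx: "1 \<le> i" "i < j" "j \<le> k" "k \<le> n - 1"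
    and sing: "one_singular n k i j vbar" and vbar_eq: "vbar (k, i) = vbar (k, j)"
    and D_tau: "D1 (tau k i j w) = D2 w" "D2 (tau k i j w) = D1 w"
    and D_eq: "w (k, i) = w (k, j) \<Longrightarrow> D1 w = D2 w"
    and D1_cross: "\<lbrakk>ladder n e r r'; D1 z \<ge> 0; D1 (shift_by e r s z) < 0\<rbrakk>
        \<Longrightarrow> gt_num r' r s (shifted vbar z) = 0"
    and D2_cross: "\<lbrakk>ladder n e r r'; D2 z \<ge> 0; D2 (shift_by e r s z) < 0\<rbrakk>
        \<Longrightarrow> gt_num r' r s (shifted vbar z) = 0"
    and D_single: "\<lbrakk>s \<in> {i, j}; D1 z \<ge> 0; D2 z \<ge> 0\<rbrakk>
        \<Longrightarrow> D1 (shift_by e k s z) \<ge> 0 \<or> D2 (shift_by e k s z) \<ge> 0"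
    and D_double: "\<lbrakk>ladder n e r r'; z \<noteq> tau k i j z; D1 z \<ge> 0; D2 z \<ge> 0;
        D1 (shift_by e r s z) < 0; D2 (shift_by e r s z) < 0; p \<in> {(k, i), (k, j)}\<rbrakk>
        \<Longrightarrow> gt_num r' r s (shifted (vbar(p := t)) z) = 0"
    and D_nonneg: "\<exists>w \<in> shifts n. D1 w \<ge> 0 \<and> D2 w \<ge> 0"
    and D_neg: "\<exists>w \<in> shifts n. D1 w < 0 \<and> D2 w < 0"
begin

text \<open>The sign of \<open>w (k, i) - w (k, j)\<close> tells whether the basis symbol named by
  \<open>w\<close> is a regular or a derivative tableau; this selects the weak or the strong
  condition.\<close>

definition barrier :: "tabvec set"
  where "barrier = {x \<in> tab_space n. \<forall>w \<in> Poly_Mapping.keys x.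
    if w (k, i) - w (k, j) \<le> 0 then D1 w \<ge> 0 \<or> D2 w \<ge> 0 else D1 w \<ge> 0 \<and> D2 w \<ge> 0}"

lemma barrierD:
  assumes "x \<in> barrier" "w \<in> Poly_Mapping.keys x"
  shows "w \<in> shifts n"
    and "if w (k, i) - w (k, j) \<le> 0 then D1 w \<ge> 0 \<or> D2 w \<ge> 0 else D1 w \<ge> 0 \<and> D2 w \<ge> 0"
  using assms by (auto simp: barrier_def tab_space_def)

lemma subspace_barrier: "tab.subspace barrier"
  unfolding tab.subspace_def
proof (intro conjI ballI allI)
  show "0 \<in> barrier" by (simp add: barrier_def tab_space_def)
next
  fix x y assume "x \<in> barrier" "y \<in> barrier"
  then show "x + y \<in> barrier"
    using tab.subspace_add[OF subspace_tab_space, of x n y] Poly_Mapping.keys_add[of x y]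
    unfolding barrier_def by blast
next
  fix c x assume "x \<in> barrier"
  moreover have "Poly_Mapping.keys (tab_scale c x) \<subseteq> Poly_Mapping.keys x"
    by (auto simp: in_keys_iff lookup_tab_scale)
  ultimately show "tab_scale c x \<in> barrier"
    using tab.subspace_scale[OF subspace_tab_space, of x n c] unfolding barrier_def by blast
qed

text \<open>Rewriting a tableau to its basis symbol may apply \<open>tau\<close>, which exchanges
  \<open>D1\<close> and \<open>D2\<close>; the condition is symmetric in them.\<close>

lemma Treg_barrier: "w \<in> shifts n \<Longrightarrow> D1 w \<ge> 0 \<or> D2 w \<ge> 0 \<Longrightarrow> Treg k i j w \<in> barrier"
  using tau_shifts[OF idx, of w] tau_at[of i j k w] idx
  by (auto simp: Treg_def barrier_def tab_space_def D_tau)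

lemma Tder_barrier: "w \<in> shifts n \<Longrightarrow> D1 w \<ge> 0 \<Longrightarrow> D2 w \<ge> 0 \<Longrightarrow> Tder k i j w \<in> barrier"
  using tau_shifts[OF idx, of w] tau_at[of i j k w] idx
  by (auto simp: Tder_def barrier_def tab_space_def D_tau)

text \<open>By linearity it suffices to treat basis symbols. Those of derivative type have
  \<open>w (k, i) > w (k, j)\<close>, so they are never fixed by \<open>tau\<close> and the formulas
  for \<open>Tder\<close> apply.\<close>

lemma barrier_maps:
  assumes A: "A \<in> carrier_mat n n"
    and T: "\<And>z. \<lbrakk>z \<in> shifts n; D1 z \<ge> 0 \<or> D2 z \<ge> 0\<rbrakk> \<Longrightarrow> \<rho> A (Treg k i j z) \<in> barrier"
    and D: "\<And>z. \<lbrakk>z \<in> shifts n; z \<noteq> tau k i j z; D1 z \<ge> 0; D2 z \<ge> 0\<rbrakk>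
        \<Longrightarrow> \<rho> A (Tder k i j z) \<in> barrier"
    and x: "x \<in> barrier"
  shows "\<rho> A x \<in> barrier"
proof -
  have b: "\<rho> A (Poly_Mapping.single w 1) \<in> barrier" if w: "w \<in> Poly_Mapping.keys x" for w
  proof (cases "w (k, i) - w (k, j) \<le> 0")
    case True
    then have "Poly_Mapping.single w 1 = Treg k i j w" by (simp add: Treg_def)
    moreover have "w \<in> shifts n" "D1 w \<ge> 0 \<or> D2 w \<ge> 0"
      using True barrierD[OF x w] by auto
    ultimately show ?thesis using T by simp
  next
    case False
    then have "Poly_Mapping.single w 1 = Tder k i j w" "w \<noteq> tau k i j w"
      using tau_at[of i j k w] idx by (auto simp: Tder_def)
    moreover have "w \<in> shifts n" "D1 w \<ge> 0" "D2 w \<ge> 0"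
      using False barrierD[OF x w] by auto
    ultimately show ?thesis using D by simp
  qed
  have "\<rho> A (\<Sum>w\<in>Poly_Mapping.keys x. tab_scale (Poly_Mapping.lookup x w) (Poly_Mapping.single w 1))
      = (\<Sum>w\<in>Poly_Mapping.keys x. tab_scale (Poly_Mapping.lookup x w) (\<rho> A (Poly_Mapping.single w 1)))"
    using x by (intro map_sum A) (auto simp: barrier_def tab_space_def)
  also have "\<dots> \<in> barrier"
    by (intro tab.subspace_sum tab.subspace_scale subspace_barrier b)
  finally show ?thesis by (simp flip: tabvec_expand)
qed

section \<open>Stability under raising and lowering operators\<close>

context
  fixes e :: int and r r' :: nat and c :: complex
  assumes lad: "ladder n e r r'"
begin

interpretation ladder n e r r' by (rule lad)

abbreviation "target z s \<equiv> shift_by e r s z"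

text \<open>By 1-singularity only the denominator factor of the pair \<open>i\<close>,
  \<open>j\<close> could vanish at \<open>vbar\<close>; there it equals a difference of entries of
  \<open>z\<close>, which is nonzero by assumption.\<close>

lemma smooth_domain:
  assumes s: "1 \<le> s" "s \<le> r" and smooth: "r \<noteq> k \<or> s \<notin> {i, j} \<or> z (k, i) \<noteq> z (k, j)"
  obtains U where "open U" "vbar \<in> U" "continuous_on U (\<lambda>v. gt_coeff c r' r s (shifted v z))"
proof
  let ?den = "\<lambda>v. \<Prod>q \<in> {1..r} - {s}. shifted v z (r, s) - shifted v z (r, q)"
  let ?U = "{v. ?den v \<noteq> 0}"
  have "continuous_on UNIV ?den" by (intro continuous_intros)
  then show "open ?U"
    by (intro open_Collect_neq) auto
  have "shifted vbar z (r, s) - shifted vbar z (r, q) \<noteq> 0" if q: "q \<in> {1..r} - {s}" for q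
  proof (cases "r = k \<and> {s, q} = {i, j}")
    case True
    then have "z (k, i) \<noteq> z (k, j)" using smooth by auto
    then show ?thesis using True vbar_eq idx by (auto simp: shifted_def doubleton_eq_iff)
  next
    case False
    then show ?thesis using one_singular_diff[OF sing s] q row by auto
  qed
  then show "vbar \<in> ?U" by simp
  show "continuous_on ?U (\<lambda>v. gt_coeff c r' r s (shifted v z))"
    unfolding gt_coeff_def by (intro continuous_intros continuous_on_gt_num) auto
qed

text \<open>The prefactor cancels the one vanishing denominator factor up to sign. The remaining
  quotient is continuous at \<open>vbar\<close> and still contains the numerator.\<close>

lemma singular_rat_val:
  assumes s: "s \<in> {i, j}" and r: "r = k" and z: "z (k, i) = z (k, j)"
    and num: "gt_num r' r s (shifted vbar z) = 0"
  shows "rat_val k i j (\<lambda>v. (v (k, i) - v (k, j)) * gt_coeff c r' r s (shifted v z)) vbar = 0"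
proof -
  \<comment> \<open>\<open>o'\<close> is the partner of \<open>s\<close> in the singular pair, and
    \<open>sg\<close> is the sign of its denominator factor relative to
    \<open>u (k, i) - u (k, j)\<close>.\<close>
  define o' where "o' = (if s = i then j else i)"
  define sg where "sg = (if s = i then 1 else - 1 :: complex)"
  let ?den = "\<lambda>v. \<Prod>q \<in> {1..k} - {i, j}. shifted v z (r, s) - shifted v z (r, q)"
  let ?U = "{v. ?den v \<noteq> 0}"
  let ?g = "\<lambda>v. sg * (c * gt_num r' r s (shifted v z)) / ?den v"
  have "continuous_on UNIV ?den" by (intro continuous_intros)
  then have U: "open ?U" by (intro open_Collect_neq) auto
  have "shifted vbar z (r, s) - shifted vbar z (r, q) \<noteq> 0" if q: "q \<in> {1..k} - {i, j}" for q
    using that s r idx row by (intro one_singular_diff[OF sing]) auto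
  then have v: "vbar \<in> ?U" by simp
  have g: "continuous_on ?U ?g"
    by (intro continuous_intros continuous_on_gt_num) auto
  have "rat_val k i j (\<lambda>v. (v (k, i) - v (k, j)) * gt_coeff c r' r s (shifted v z)) vbar = ?g vbar"
  proof (rule rat_val_open[OF _ U g v])
    fix u :: cvec assume "u \<in> ?U" and u: "u (k, i) \<noteq> u (k, j)"
    have set: "{1..r} - {s} = insert o' ({1..k} - {i, j})" "o' \<notin> {1..k} - {i, j}"
      using s r idx by (auto simp: o'_def)
    have "(\<Prod>q \<in> {1..r} - {s}. shifted u z (r, s) - shifted u z (r, q))
        = sg * (u (k, i) - u (k, j)) * ?den u"
      unfolding set(1) using set(2) s r z idx
      by (subst prod.insert) (auto simp: o'_def sg_def shifted_def)
    then show "(u (k, i) - u (k, j)) * gt_coeff c r' r s (shifted u z) = ?g u"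
      using u unfolding gt_coeff_def by (simp add: sg_def)
  qed (use idx in auto)
  then show ?thesis using num by simp
qed

text \<open>For a smooth coefficient only the regular term survives, and it vanishes when both walls
  end up negative. For a singular one both walls start nonnegative: crossing either kills the
  derivative term, and \<open>D_single\<close> keeps the regular target admissible.\<close>

lemma T_image_barrier:
  assumes z: "z \<in> shifts n" "D1 z \<ge> 0 \<or> D2 z \<ge> 0"
  shows "T_image k i j vbar r (gt_coeff c r' r) (target z) z \<in> barrier"
  unfolding T_image_def Let_def
proof (intro tab.subspace_sum[OF subspace_barrier])
  fix s assume "s \<in> {1..r}"
  then have s: "1 \<le> s" "s \<le> r" by auto
  let ?f = "\<lambda>v. (v (k, i) - v (k, j)) * gt_coeff c r' r s (shifted v z)"
  have "Dv k i j vbar ?f = 0 \<or> D1 (target z s) \<ge> 0 \<or> D2 (target z s) \<ge> 0"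
    and "rat_val k i j ?f vbar = 0 \<or> D1 (target z s) \<ge> 0 \<and> D2 (target z s) \<ge> 0"
  proof -
    consider (smooth) "r \<noteq> k \<or> s \<notin> {i, j} \<or> z (k, i) \<noteq> z (k, j)"
      | (sing) "r = k" "s \<in> {i, j}" "z (k, i) = z (k, j)" by blast
    then have "(Dv k i j vbar ?f = 0 \<or> D1 (target z s) \<ge> 0 \<or> D2 (target z s) \<ge> 0) \<and>
      (rat_val k i j ?f vbar = 0 \<or> D1 (target z s) \<ge> 0 \<and> D2 (target z s) \<ge> 0)"
    proof cases
      case smooth
      obtain U where "open U" "vbar \<in> U" "continuous_on U (\<lambda>v. gt_coeff c r' r s (shifted v z))"
        using smooth_domain[OF s smooth] .
      with smooth_coefficient[of i j U _ vbar k] vbar_eq idx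
      have "rat_val k i j ?f vbar = 0" "Dv k i j vbar ?f = gt_coeff c r' r s (shifted vbar z)"
        by blast+
      moreover have "gt_coeff c r' r s (shifted vbar z) = 0"
        if "D1 (target z s) < 0" "D2 (target z s) < 0"
        using z(2) D1_cross[OF lad] D2_cross[OF lad] that unfolding gt_coeff_def
        by (metis div_0 mult_zero_right)
      ultimately show ?thesis unfolding not_less[symmetric] by auto
    next
      case sing
      \<comment> \<open>Equal entries of \<open>z\<close> force \<open>D1 z = D2 z\<close>, which
        turns the disjunction into a conjunction.\<close>
      then have D: "D1 z \<ge> 0" "D2 z \<ge> 0" using D_eq[of z] z(2) by auto
      then have "rat_val k i j ?f vbar = 0"
        if "D1 (target z s) < 0 \<or> D2 (target z s) < 0"
        using singular_rat_val[OF sing(2,1,3)] D1_cross[OF lad] D2_cross[OF lad] that by blast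
      moreover have "D1 (target z s) \<ge> 0 \<or> D2 (target z s) \<ge> 0"
        using D_single[OF sing(2) D] sing(1) by simp
      ultimately show ?thesis unfolding not_less[symmetric] by blast
    qed
    then show "Dv k i j vbar ?f = 0 \<or> D1 (target z s) \<ge> 0 \<or> D2 (target z s) \<ge> 0"
      "rat_val k i j ?f vbar = 0 \<or> D1 (target z s) \<ge> 0 \<and> D2 (target z s) \<ge> 0" by blast+
  qed
  then have "tab_scale (Dv k i j vbar ?f) (Treg k i j (target z s)) \<in> barrier"
    "tab_scale (rat_val k i j ?f vbar) (Tder k i j (target z s)) \<in> barrier"
    using Treg_barrier[OF shift_by_shifts[OF z(1) s]] Tder_barrier[OF shift_by_shifts[OF z(1) s]]
      subspace_barrier by (auto intro: tab.subspace_scale tab.subspace_0)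
  then show "tab_scale (Dv k i j vbar ?f) (Treg k i j (target z s))
      + tab_scale (rat_val k i j ?f vbar) (Tder k i j (target z s)) \<in> barrier"
    by (rule tab.subspace_add[OF subspace_barrier])
qed

text \<open>Since \<open>tau\<close> moves \<open>z\<close>, the coefficient is smooth. Crossing one
  wall annihilates the derivative term; crossing both makes the numerator vanish along both
  coordinate lines by \<open>D_double\<close>, so the regular term goes too.\<close>

lemma D_image_barrier:
  assumes z: "z \<in> shifts n" "z \<noteq> tau k i j z" "D1 z \<ge> 0" "D2 z \<ge> 0"
  shows "D_image k i j vbar r (gt_coeff c r' r) (target z) z \<in> barrier"
  unfolding D_image_def
proof (intro tab.subspace_sum[OF subspace_barrier])
  fix s assume "s \<in> {1..r}"
  then have s: "1 \<le> s" "s \<le> r" by auto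
  let ?f = "\<lambda>v. gt_coeff c r' r s (shifted v z)"
  have "z (k, i) \<noteq> z (k, j)" using z(2) tau_fixed[of z k i j] by auto
  then obtain U where U: "open U" "vbar \<in> U" "continuous_on U ?f"
    using smooth_domain[OF s] by blast
  have "Dv k i j vbar ?f = 0" if "D1 (target z s) < 0" "D2 (target z s) < 0"
    using D_double[OF lad z(2-4) that] idx
    by (intro Dv_eq_0[OF _ U(1,3,2)]) (auto simp: gt_coeff_def)
  moreover have "?f vbar = 0" if "D1 (target z s) < 0 \<or> D2 (target z s) < 0"
    using z(3,4) D1_cross[OF lad] D2_cross[OF lad] that unfolding gt_coeff_def
    by (metis div_0 mult_zero_right)
  ultimately have "Dv k i j vbar ?f = 0 \<or> D1 (target z s) \<ge> 0 \<or> D2 (target z s) \<ge> 0"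
    and "?f vbar = 0 \<or> D1 (target z s) \<ge> 0 \<and> D2 (target z s) \<ge> 0"
    unfolding not_less[symmetric] by blast+
  then have "tab_scale (Dv k i j vbar ?f) (Treg k i j (target z s)) \<in> barrier"
    "tab_scale (?f vbar) (Tder k i j (target z s)) \<in> barrier"
    using Treg_barrier[OF shift_by_shifts[OF z(1) s]] Tder_barrier[OF shift_by_shifts[OF z(1) s]]
      subspace_barrier by (auto intro: tab.subspace_scale tab.subspace_0)
  then show "tab_scale (Dv k i j vbar ?f) (Treg k i j (target z s))
      + tab_scale (?f vbar) (Tder k i j (target z s)) \<in> barrier"
    by (rule tab.subspace_add[OF subspace_barrier])
qed

end

lemma submodule_barrier: "submodule barrier"
proof (rule submodule_from_generators)
  show "barrier \<subseteq> tab_space n" by (auto simp: barrier_def)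
next
  fix r x assume r: "1 \<le> r" "r \<le> n" and x: "x \<in> barrier"
  show "\<rho> (Emat n r r) x \<in> barrier"
    by (rule barrier_maps[OF _ _ _ x])
      (auto simp: diag_T[OF r] diag_D[OF r]
        intro!: tab.subspace_scale subspace_barrier Treg_barrier Tder_barrier)
next
  fix r x assume r: "1 \<le> r" "r \<le> n - 1" and x: "x \<in> barrier"
  have "ladder n 1 r (r + 1)" using r by unfold_locales auto
  from T_image_barrier[OF this] D_image_barrier[OF this] show "\<rho> (Emat n r (r + 1)) x \<in> barrier"
    by (intro barrier_maps[OF _ _ _ x]) (simp_all only: raise_T raise_D r a_plus_eq Emat_carrier not_False_eq_True)
  have "ladder n (- 1) r (r - 1)" using r by unfold_locales auto
  from T_image_barrier[OF this] D_image_barrier[OF this] show "\<rho> (Emat n (r + 1) r) x \<in> barrier"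
    by (intro barrier_maps[OF _ _ _ x]) (simp_all only: lower_T lower_D r a_minus_eq Emat_carrier not_False_eq_True)
qed (rule subspace_barrier)

text \<open>A basis symbol with both walls nonnegative shows that \<open>barrier\<close> is nonzero,
  and one with both negative that it is proper.\<close>

lemma reducible: "\<not> irreducible_module"
proof
  assume "irreducible_module"
  then have "barrier = {0} \<or> barrier = tab_space n"
    using submodule_barrier by (simp add: irreducible_module_def)
  moreover obtain w where "w \<in> shifts n" "D1 w \<ge> 0" "D2 w \<ge> 0" using D_nonneg by blast
  then have "Poly_Mapping.single w 1 \<in> barrier" by (simp add: barrier_def tab_space_def)
  moreover have "Poly_Mapping.single w 1 \<noteq> (0 :: tabvec)"
    by (metis lookup_single_eq lookup_zero one_neq_zero)
  moreover obtain u where "u \<in> shifts n" "D1 u < 0" "D2 u < 0" using D_neg by blast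
  then have "Poly_Mapping.single u 1 \<in> tab_space n" "Poly_Mapping.single u 1 \<notin> barrier"
    by (simp_all add: barrier_def tab_space_def)
  ultimately show False by auto
qed

end

section \<open>Position of the integral difference relative to the singular pair\<close>

theorem theorem7p7:
  fixes n k i j :: nat and vbar :: cvec and \<rho> :: "complex mat \<Rightarrow> tabvec \<Rightarrow> tabvec"
  assumes "n \<ge> 2" and "1 \<le> i" and "i < j" and "j \<le> k" and "k \<le> n - 1"
    and "one_singular n k i j vbar" and "vbar (k, i) = vbar (k, j)"
    and "singular_GT_module n \<rho> k i j vbar"
    and "gl_module.irreducible_module tab_scale n (tab_space n) \<rho>"
  shows "\<forall>r s t. 2 \<le> r \<and> r \<le> n \<and> 1 \<le> s \<and> s \<le> r \<and> 1 \<le> t \<and> t \<le> r - 1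
           \<longrightarrow> vbar (r, s) - vbar (r - 1, t) \<notin> \<int>"
proof (intro allI impI notI, elim conjE)
  fix R S T
  assume R: "2 \<le> R" "R \<le> n" and S: "1 \<le> S" "S \<le> R" and T: "1 \<le> T" "T \<le> R - 1"
  assume "vbar (R, S) - vbar (R - 1, T) \<in> \<int>"
  then obtain m where m: "vbar (R, S) - vbar (R - 1, T) = of_int m" by (elim Ints_cases)
  interpret singular_GT_module n \<rho> k i j vbar by fact
  have w_tau: "w = tau k i j w" if "w (k, i) = w (k, j)" for w
    using tau_fixed[OF that] by simp
  consider (A) "(R, S) \<notin> {(k, i), (k, j)}" "(R - 1, T) \<notin> {(k, i), (k, j)}"
    | (B) "R = k" "S \<in> {i, j}" | (C) "R - 1 = k" "T \<in> {i, j}" by blast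
  then show False
  proof cases
    case A
    \<comment> \<open>The wall avoids the singular pair, so \<open>tau\<close> preserves it and
      \<open>D1 = D2\<close>.\<close>
    let ?D = "\<lambda>w::shift. m + w (R, S) - w (R - 1, T)"
    have inv: "?D (tau k i j w) = ?D w" for w using A by (auto simp: tau_def)
    have cross: "gt_num r' r s (shifted v z) = 0"
      if "ladder n e r r'" "?D z \<ge> 0" "?D (shift_by e r s z) < 0"
        "v (R, S) - v (R - 1, T) = of_int m" for e r r' s z v
      using ladder.crossing[OF that(1) S T that(4,2,3)] .
    interpret GT_barrier n \<rho> k i j vbar ?D ?D
    proof
      show "\<exists>w \<in> shifts n. ?D w \<ge> 0 \<and> ?D w \<ge> 0"
        \<comment> \<open>Row \<open>R\<close> may be the top row, which shifts leave fixed, so the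
          lower entry is moved; this gives the value 0, and \<open>m + 1\<close> below gives
          -1.\<close>
        by (rule bexI[of _ "\<lambda>p. m * delta (R - 1) T p"])
          (use R S T in \<open>auto simp: delta_def shifts_def\<close>)
      show "\<exists>w \<in> shifts n. ?D w < 0 \<and> ?D w < 0"
        by (rule bexI[of _ "\<lambda>p. (m + 1) * delta (R - 1) T p"])
          (use R S T in \<open>auto simp: delta_def shifts_def\<close>)
    next
      fix s :: nat and z :: shift and e :: int
      assume "s \<in> {i, j}" "?D z \<ge> 0"
      then show "?D (shift_by e k s z) \<ge> 0 \<or> ?D (shift_by e k s z) \<ge> 0"
        using A by (auto simp: shift_by_def delta_def)
    next
      fix e r r' z s p t
      assume *: "ladder n e r r'" "?D z \<ge> 0" "?D (shift_by e r s z) < 0" "p \<in> {(k, i), (k, j)}"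
      \<comment> \<open>Changing \<open>vbar\<close> at \<open>p\<close> does not affect the
        difference \<open>m\<close>, so \<open>crossing\<close> applies to the altered base
        vector.\<close>
      show "gt_num r' r s (shifted (vbar(p := t)) z) = 0"
        by (rule cross[OF *(1-3)]) (use *(4) A m in auto)
    next
      fix e r r' s and z :: shift
      assume *: "ladder n e r r'" "?D z \<ge> 0" "?D (shift_by e r s z) < 0"
      show "gt_num r' r s (shifted vbar z) = 0" by (rule cross[OF * m])
    qed (use assms inv in simp_all)
    from reducible assms(9) show False by simp
  next
    case B
    let ?D = "\<lambda>a w::shift. m + w (k, a) - w (k - 1, T)"
    \<comment> \<open>As \<open>vbar (k, i) = vbar (k, j)\<close>, the same \<open>m\<close> serves
      both walls.\<close>
    have vm: "vbar (k, a) - vbar (k - 1, T) = of_int m" if "a \<in> {i, j}" for a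
      using m B that assms(7) by auto
    have cross: "gt_num r' r s (shifted vbar z) = 0"
      if "ladder n e r r'" "?D a z \<ge> 0" "?D a (shift_by e r s z) < 0" "a \<in> {i, j}" for e r r' s z a
      by (rule ladder.crossing[OF that(1) _ _ _ _ vm[OF that(4)] that(2,3)])
        (use that(4) assms T B in auto)
    have k: "k \<noteq> k - 1" using assms by auto
    interpret GT_barrier n \<rho> k i j vbar "?D i" "?D j"
    proof
      show "\<exists>w \<in> shifts n. ?D i w \<ge> 0 \<and> ?D j w \<ge> 0"
        by (rule bexI[of _ "\<lambda>p. m * delta (k - 1) T p"])
          (use k R B S T in \<open>auto simp: delta_def shifts_def\<close>)
      show "\<exists>w \<in> shifts n. ?D i w < 0 \<and> ?D j w < 0"
        by (rule bexI[of _ "\<lambda>p. (m + 1) * delta (k - 1) T p"])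
          (use k R B S T in \<open>auto simp: delta_def shifts_def\<close>)
    next
      fix s :: nat and z :: shift and e :: int
      assume "s \<in> {i, j}" "?D i z \<ge> 0" "?D j z \<ge> 0"
      then show "?D i (shift_by e k s z) \<ge> 0 \<or> ?D j (shift_by e k s z) \<ge> 0"
        using k assms(3) by (auto simp: shift_by_def delta_def)
    next
      fix e r r' s and p :: "nat \<times> nat" and t :: complex and z :: shift
      assume *: "ladder n e r r'" "z \<noteq> tau k i j z" "?D i z \<ge> 0" "?D j z \<ge> 0"
        "?D i (shift_by e r s z) < 0" "?D j (shift_by e r s z) < 0"
      \<comment> \<open>Only a unit step at \<open>(k - 1, T)\<close> lowers both walls at once.
        Both then start at 0, so \<open>z (k, i) = z (k, j)\<close>, contradicting that
        \<open>tau\<close> moves \<open>z\<close>.\<close>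
      have "e = 1 \<or> e = - 1" using *(1) by (auto simp: ladder_def)
      with * k assms(3) have "z (k, i) = z (k, j)"
        by (auto simp: shift_by_def delta_def split: if_splits)
      with w_tau * show "gt_num r' r s (shifted (vbar(p := t)) z) = 0" by blast
    next
      fix e r r' s and z :: shift
      assume *: "ladder n e r r'" "?D i z \<ge> 0" "?D i (shift_by e r s z) < 0"
      show "gt_num r' r s (shifted vbar z) = 0" by (rule cross[OF *]) simp
    next
      fix e r r' s and z :: shift
      assume *: "ladder n e r r'" "?D j z \<ge> 0" "?D j (shift_by e r s z) < 0"
      show "gt_num r' r s (shifted vbar z) = 0" by (rule cross[OF *]) simp
    qed (use assms k in \<open>simp_all add: tau_def\<close>)
    from reducible assms(9) show False by simp
  next
    case C
    let ?D = "\<lambda>a w::shift. m + w (k + 1, S) - w (k, a)"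
    have R_eq: "R = k + 1" using C R by auto
    \<comment> \<open>The unsimplified \<open>k + 1 - 1\<close> matches \<open>R - 1\<close> in
      \<open>crossing\<close>.\<close>
    have vm: "vbar (k + 1, S) - vbar (k + 1 - 1, a) = of_int m" if "a \<in> {i, j}" for a
      using m C that assms(7) R_eq by auto
    have cross: "gt_num r' r s (shifted vbar z) = 0"
      if "ladder n e r r'" "?D a z \<ge> 0" "?D a (shift_by e r s z) < 0" "a \<in> {i, j}" for e r r' s z a
      by (rule ladder.crossing[OF that(1) _ _ _ _ vm[OF that(4)]])
        (use that(2-4) assms S R_eq in auto)
    interpret GT_barrier n \<rho> k i j vbar "?D i" "?D j"
    proof
      show "\<exists>w \<in> shifts n. ?D i w \<ge> 0 \<and> ?D j w \<ge> 0"
        \<comment> \<open>Row \<open>k + 1\<close> may be the top row, so both singular entries are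
          shifted alike.\<close>
        by (rule bexI[of _ "\<lambda>p. m * (delta k i p + delta k j p)"])
          (use assms in \<open>auto simp: delta_def shifts_def\<close>)
      show "\<exists>w \<in> shifts n. ?D i w < 0 \<and> ?D j w < 0"
        by (rule bexI[of _ "\<lambda>p. (m + 1) * (delta k i p + delta k j p)"])
          (use assms in \<open>auto simp: delta_def shifts_def\<close>)
    next
      fix s :: nat and z :: shift and e :: int
      assume "s \<in> {i, j}" "?D i z \<ge> 0" "?D j z \<ge> 0"
      then show "?D i (shift_by e k s z) \<ge> 0 \<or> ?D j (shift_by e k s z) \<ge> 0"
        using assms(3) by (auto simp: shift_by_def delta_def)
    next
      fix e r r' s and p :: "nat \<times> nat" and t :: complex and z :: shift
      assume *: "ladder n e r r'" "z \<noteq> tau k i j z" "?D i z \<ge> 0" "?D j z \<ge> 0"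
        "?D i (shift_by e r s z) < 0" "?D j (shift_by e r s z) < 0"
      \<comment> \<open>Here only a step at \<open>(k + 1, S)\<close> lowers both walls, again from
        0.\<close>
      have "e = 1 \<or> e = - 1" using *(1) by (auto simp: ladder_def)
      with * assms(3) have "z (k, i) = z (k, j)"
        by (auto simp: shift_by_def delta_def split: if_splits)
      with w_tau * show "gt_num r' r s (shifted (vbar(p := t)) z) = 0" by blast
    next
      fix e r r' s and z :: shift
      assume *: "ladder n e r r'" "?D i z \<ge> 0" "?D i (shift_by e r s z) < 0"
      show "gt_num r' r s (shifted vbar z) = 0" by (rule cross[OF *]) simp
    next
      fix e r r' s and z :: shift
      assume *: "ladder n e r r'" "?D j z \<ge> 0" "?D j (shift_by e r s z) < 0"
      show "gt_num r' r s (shifted vbar z) = 0" by (rule cross[OF *]) simp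
    qed (use assms in \<open>simp_all add: tau_def\<close>)
    from reducible assms(9) show False by simp
  qed
qed

end
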